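(* Neither $\mathtt{A^-S^*S^-}$ nor $\mathtt{S^-S^*S^-}$ occurs as a subsequence of the sepr-sequence of any Hermitian matrix.
   Context: Let $B \in \mathbb{C}^{n\times n}$ be Hermitian. For $\alpha\subseteq\{1,\dots,n\}$ with $|\alpha|=k\ge 1$, the determinant of the submatrix $B[\alpha]$ lying in the rows and columns indexed by $\alpha$ is a principal minor of order $k$ (it is a real number). The signed enhanced principal rank characteristic sequence (sepr-sequence) of $B$ is $\operatorname{sepr}(B)=t_1t_2\cdots t_n$, where each $t_k$ is one of the seven symbols $\mathtt{A^*},\mathtt{A^+},\mathtt{A^-},\mathtt{N},\mathtt{S^*},\mathtt{S^+},\mathtt{S^-}$, determined as follows: - $t_k=\mathtt{A^*}$ if all order-$k$ principal minors of $B$ are nonzero and there are both positive and negative ones; - $t_k=\mathtt{A^+}$ (respectively $\mathtt{A^-}$) if all order-$k$ principal minors of $B$ are positive (respectively negative); - $t_k=\mathtt{N}$ if all order-$k$ principal minors of $B$ are zero; - $t_k=\mathtt{S^*}$ if $B$ has a positive, a negative and a zero order-$k$ principal minor; - $t_k=\mathtt{S^+}$ (respectively $\mathtt{S^-}$) if $B$ has both a zero and a nonzero order-$k$ principal minor and all nonzero order-$k$ principal minors are positive (respectively negative). A subsequence of $x_1x_2\cdots x_n$ means a block of consecutive terms $x_px_{p+1}\cdots x_q$ with $1\le p\le q\le n$. *)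

theory Defs
  imports
    "Jordan_Normal_Form.Schur_Decomposition"
    "Jordan_Normal_Form.DL_Submatrix"
    "HOL-Library.Sublist"
begin

text \<open>
  Rows and columns are indexed from 0, so the index set of an n by n matrix is
  \<open>{..<n}\<close> rather than {1, ..., n}.
\<close>

definition hermitian_mat :: "complex mat \<Rightarrow> bool" where
  "hermitian_mat B \<longleftrightarrow> mat_adjoint B = B"

definition principal_minor :: "complex mat \<Rightarrow> nat set \<Rightarrow> complex" where
  "principal_minor B \<alpha> = det (submatrix B \<alpha> \<alpha>)"

definition principal_minors :: "complex mat \<Rightarrow> nat \<Rightarrow> complex set" where
  "principal_minors B k = {principal_minor B \<alpha> | \<alpha>. \<alpha> \<subseteq> {..<dim_row B} \<and> card \<alpha> = k}"

datatype sepr_symbol = A_star | A_plus | A_minus | N | S_star | S_plus | S_minus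

text \<open>
  The order on \<^typ>\<open>complex\<close> is the partial one of \<^theory>\<open>HOL-Library.Complex_Order\<close>:
  \<open>0 < z\<close> means that \<open>z\<close> is real and positive. The conditions below are tested in turn; for a
  Hermitian matrix of size n and \<open>1 \<le> k \<le> n\<close> the minors are real and there is at least one,
  so exactly one of the seven cases applies (see \<open>sepr_symbol_of_iff\<close>).
\<close>

definition sepr_symbol_of :: "complex mat \<Rightarrow> nat \<Rightarrow> sepr_symbol" where
  "sepr_symbol_of B k =
    (let M = principal_minors B k in
     if (\<forall>d\<in>M. d \<noteq> 0) \<and> (\<exists>d\<in>M. 0 < d) \<and> (\<exists>d\<in>M. d < 0) then A_star
     else if \<forall>d\<in>M. 0 < d then A_plus
     else if \<forall>d\<in>M. d < 0 then A_minus
     else if \<forall>d\<in>M. d = 0 then N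
     else if (\<exists>d\<in>M. 0 < d) \<and> (\<exists>d\<in>M. d < 0) \<and> (\<exists>d\<in>M. d = 0) then S_star
     else if (\<exists>d\<in>M. d = 0) \<and> (\<exists>d\<in>M. d \<noteq> 0) \<and> (\<forall>d\<in>M. d \<noteq> 0 \<longrightarrow> 0 < d) then S_plus
     else S_minus)"

definition sepr :: "complex mat \<Rightarrow> sepr_symbol list" where
  "sepr B = map (sepr_symbol_of B) [1..<Suc (dim_row B)]"

lemma hermitian_mat_dim:
  assumes "hermitian_mat B"
  shows "dim_col B = dim_row B"
proof -
  have "dim_row (mat_adjoint B) = dim_col B"
    by (simp add: mat_adjoint_def)
  with assms show ?thesis
    by (simp add: hermitian_mat_def)
qed

lemma hermitian_mat_index:
  assumes "hermitian_mat B" "i < dim_row B" "j < dim_row B"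
  shows "B $$ (i, j) = cnj (B $$ (j, i))"
proof -
  have "B $$ (i, j) = mat_adjoint B $$ (i, j)"
    using assms(1) by (simp add: hermitian_mat_def)
  also have "\<dots> = cnj (B $$ (j, i))"
    using assms hermitian_mat_dim[OF assms(1)] by (simp add: mat_adjoint_def mat_of_rows_def)
  finally show ?thesis .
qed

lemma principal_minor_real:
  assumes B: "hermitian_mat B"
  shows "principal_minor B \<alpha> \<in> \<real>"
proof -
  let ?S = "submatrix B \<alpha> \<alpha>"
  define m where "m = card {i. i < dim_row B \<and> i \<in> \<alpha>}"
  have S: "?S \<in> carrier_mat m m"
    by (rule carrier_matI) (simp_all only: dim_submatrix hermitian_mat_dim[OF B] m_def)
  have pick: "pick \<alpha> i < dim_row B" if "i < m" for i
    using that unfolding m_def by (rule pick_le)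
  have "map_mat cnj ?S = transpose_mat ?S"
  proof (rule eq_matI)
    fix i j assume "i < dim_row (transpose_mat ?S)" "j < dim_col (transpose_mat ?S)"
    with S have ij: "i < m" "j < m" by auto
    have sub: "?S $$ (x, y) = B $$ (pick \<alpha> x, pick \<alpha> y)" if "x < m" "y < m" for x y
      by (rule submatrix_index) (use that in \<open>simp_all only: hermitian_mat_dim[OF B] m_def\<close>)
    have "map_mat cnj ?S $$ (i, j) = cnj (?S $$ (i, j))"
      using S ij by (intro index_map_mat) auto
    also have "\<dots> = B $$ (pick \<alpha> j, pick \<alpha> i)"
      using hermitian_mat_index[OF B pick[OF ij(2)] pick[OF ij(1)]] by (simp only: sub[OF ij])
    also have "\<dots> = ?S $$ (j, i)"
      by (simp only: sub[OF ij(2,1)])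
    also have "\<dots> = transpose_mat ?S $$ (i, j)"
      using S ij by (intro index_transpose_mat(1)[symmetric]) auto
    finally show "map_mat cnj ?S $$ (i, j) = transpose_mat ?S $$ (i, j)" .
  qed (use S in auto)
  moreover have "comm_ring_hom cnj"
    by unfold_locales auto
  then have "det (map_mat cnj ?S) = cnj (det ?S)"
    by (rule comm_ring_hom.hom_det)
  ultimately have "cnj (det ?S) = det ?S"
    using det_transpose[OF S] by metis
  then show ?thesis
    by (simp only: principal_minor_def Reals_cnj_iff)
qed

lemma principal_minors_trichotomy:
  assumes "hermitian_mat B" "d \<in> principal_minors B k"
  shows "d < 0 \<or> d = 0 \<or> 0 < d"
proof -
  have "d \<in> \<real>"
    using assms principal_minor_real unfolding principal_minors_def by auto
  then show ?thesis
    unfolding complex_is_real_iff_compare0 order.order_iff_strict by auto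
qed

lemma principal_minors_nonempty:
  assumes "k \<le> dim_row B"
  shows "principal_minors B k \<noteq> {}"
  using assms unfolding principal_minors_def
  by (auto intro!: exI[of _ "{..<k}"])

lemma sepr_symbol_of_iff:
  assumes "hermitian_mat B" "k \<le> dim_row B"
  defines "M \<equiv> principal_minors B k"
  shows
    "sepr_symbol_of B k = A_star \<longleftrightarrow> (\<forall>d\<in>M. d \<noteq> 0) \<and> (\<exists>d\<in>M. 0 < d) \<and> (\<exists>d\<in>M. d < 0)"
    "sepr_symbol_of B k = A_plus \<longleftrightarrow> (\<forall>d\<in>M. 0 < d)"
    "sepr_symbol_of B k = A_minus \<longleftrightarrow> (\<forall>d\<in>M. d < 0)"
    "sepr_symbol_of B k = N \<longleftrightarrow> (\<forall>d\<in>M. d = 0)"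
    "sepr_symbol_of B k = S_star \<longleftrightarrow> (\<exists>d\<in>M. 0 < d) \<and> (\<exists>d\<in>M. d < 0) \<and> (\<exists>d\<in>M. d = 0)"
    "sepr_symbol_of B k = S_plus \<longleftrightarrow>
      (\<exists>d\<in>M. d = 0) \<and> (\<exists>d\<in>M. d \<noteq> 0) \<and> (\<forall>d\<in>M. d \<noteq> 0 \<longrightarrow> 0 < d)"
    "sepr_symbol_of B k = S_minus \<longleftrightarrow>
      (\<exists>d\<in>M. d = 0) \<and> (\<exists>d\<in>M. d \<noteq> 0) \<and> (\<forall>d\<in>M. d \<noteq> 0 \<longrightarrow> d < 0)"
proof -
  have tri: "d < 0 \<or> d = 0 \<or> 0 < d" if "d \<in> M" for d
    using principal_minors_trichotomy assms(1) that unfolding M_def by blast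
  obtain e where e: "e \<in> M"
    using principal_minors_nonempty[OF assms(2)] unfolding M_def by blast
  define p q z where "p = (\<exists>d\<in>M. 0 < d)" and "q = (\<exists>d\<in>M. d < 0)" and "z = (\<exists>d\<in>M. d = 0)"
  note folds = p_def[symmetric] q_def[symmetric] z_def[symmetric]
  have conds:
    "(\<forall>d\<in>M. d \<noteq> 0) \<longleftrightarrow> \<not> z"
    "(\<forall>d\<in>M. 0 < d) \<longleftrightarrow> \<not> q \<and> \<not> z"
    "(\<forall>d\<in>M. d < 0) \<longleftrightarrow> \<not> p \<and> \<not> z"
    "(\<forall>d\<in>M. d = 0) \<longleftrightarrow> \<not> p \<and> \<not> q"
    "(\<exists>d\<in>M. d \<noteq> 0) \<longleftrightarrow> p \<or> q"
    "(\<forall>d\<in>M. d \<noteq> 0 \<longrightarrow> 0 < d) \<longleftrightarrow> \<not> q"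
    "(\<forall>d\<in>M. d \<noteq> 0 \<longrightarrow> d < 0) \<longleftrightarrow> \<not> p"
    unfolding p_def q_def z_def using tri by (blast dest: less_asym less_imp_neq)+
  have pqz: "p \<or> q \<or> z"
    using e tri unfolding p_def q_def z_def by blast
  note d = sepr_symbol_of_def[of B k, folded M_def, unfolded Let_def]
  show
    "sepr_symbol_of B k = A_star \<longleftrightarrow> (\<forall>d\<in>M. d \<noteq> 0) \<and> (\<exists>d\<in>M. 0 < d) \<and> (\<exists>d\<in>M. d < 0)"
    "sepr_symbol_of B k = A_plus \<longleftrightarrow> (\<forall>d\<in>M. 0 < d)"
    "sepr_symbol_of B k = A_minus \<longleftrightarrow> (\<forall>d\<in>M. d < 0)"
    "sepr_symbol_of B k = N \<longleftrightarrow> (\<forall>d\<in>M. d = 0)"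
    "sepr_symbol_of B k = S_star \<longleftrightarrow> (\<exists>d\<in>M. 0 < d) \<and> (\<exists>d\<in>M. d < 0) \<and> (\<exists>d\<in>M. d = 0)"
    "sepr_symbol_of B k = S_plus \<longleftrightarrow>
      (\<exists>d\<in>M. d = 0) \<and> (\<exists>d\<in>M. d \<noteq> 0) \<and> (\<forall>d\<in>M. d \<noteq> 0 \<longrightarrow> 0 < d)"
    "sepr_symbol_of B k = S_minus \<longleftrightarrow>
      (\<exists>d\<in>M. d = 0) \<and> (\<exists>d\<in>M. d \<noteq> 0) \<and> (\<forall>d\<in>M. d \<noteq> 0 \<longrightarrow> d < 0)"
    unfolding d folds conds using pqz by (cases p; cases q; cases z; simp)+
qed

end

theory Submission
  imports Defs
begin

text \<open>
  The reason lies in a single fact about three consecutive orders: if all principal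
  minors of orders \<open>k\<close> and \<open>k + 2\<close> of a Hermitian matrix \<open>B\<close> are nonpositive, then those of order
  \<open>k + 1\<close> cannot take both signs (\<open>no_sign_change_between_nonpos_minors\<close>). Write \<open>f S\<close> for the
  principal minor on \<open>S\<close>, and suppose that \<open>f T > 0 > f F\<close> with \<open>T\<close> and \<open>F\<close> of size \<open>k + 1\<close>.
  Fix \<open>T\<close> and choose \<open>F\<close> as near to \<open>T\<close> as possible, so that no set of size \<open>k + 1\<close> nearer to \<open>T\<close>
  has a negative minor.

  The main tool is the principal pivot transform \<open>M\<close> of \<open>B\<close> at \<open>F\<close> (\<open>principal_pivot_exists\<close>). Its
  principal minors \<open>m S\<close> satisfy \<open>f (sym_diff F S) = f F * m S\<close>, so each sign condition on \<open>f\<close> near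
  \<open>F\<close> becomes one on a small minor of \<open>M\<close>. Moreover \<open>M\<close> is Hermitian within \<open>F\<close> and
  within its complement, and skew-Hermitian between the two.

  Let \<open>x \<in> F - T\<close> and \<open>y \<in> T - F\<close>. Removing \<open>x\<close> from \<open>F\<close> gives size \<open>k\<close> and adding \<open>y\<close> gives size
  \<open>k + 2\<close>, so the diagonal entries \<open>M x x\<close> and \<open>M y y\<close> are nonnegative. Exchanging \<open>x\<close> for \<open>y\<close> gives
  a set nearer to \<open>T\<close>, so \<open>m {x, y} = M x x * M y y + |M x y|^2\<close> is nonpositive. Hence
  \<open>M x y = 0\<close> and one of \<open>M x x\<close>, \<open>M y y\<close> vanishes. So \<open>M\<close>, restricted to the symmetric
  difference of \<open>F\<close> and \<open>T\<close>, is block diagonal, and it is nonsingular there because \<open>f T\<close> is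
  nonzero.

  A zero diagonal entry \<open>M z z\<close> then forces a nonzero entry \<open>M z w\<close> in the same block, and
  \<open>m {z, w} = - |M z w|^2 < 0\<close>. Multiplying such a negative pair by the remaining diagonal
  entry gives a minor of a size governed by the orders \<open>k\<close> and \<open>k + 2\<close>, which forces that
  entry to be zero as well. Now there is a negative pair \<open>{x, x'}\<close> in \<open>F - T\<close> and another,
  \<open>{y, y'}\<close>, in \<open>T - F\<close>. Their product is positive, so exchanging \<open>{x, x'}\<close> for \<open>{y, y'}\<close> in \<open>F\<close>
  yields a set with negative minor that is nearer to \<open>T\<close>: a contradiction.
\<close>

section \<open>Principal minors as determinants of full size\<close>

text \<open>
  Replacing the columns outside \<open>S\<close> by unit vectors gives a matrix whose determinant is the
  principal minor on \<open>S\<close>. All these matrices have the same size as \<open>A\<close>, so identities between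
  minors on different index sets can be read off from matrix products.
\<close>

definition unit_cols_outside :: "complex mat \<Rightarrow> nat set \<Rightarrow> complex mat" where
  "unit_cols_outside A S = mat (dim_row A) (dim_row A)
     (\<lambda>(i, j). if j \<in> S then A $$ (i, j) else if i = j then 1 else 0)"

lemma unit_cols_outside_carrier:
  assumes "A \<in> carrier_mat n n"
  shows "unit_cols_outside A S \<in> carrier_mat n n"
  using assms by (auto simp: unit_cols_outside_def)

lemma unit_cols_outside_index:
  assumes "A \<in> carrier_mat n n" "i < n" "j < n"
  shows "unit_cols_outside A S $$ (i, j) = (if j \<in> S then A $$ (i, j) else if i = j then 1 else 0)"
  using assms by (auto simp: unit_cols_outside_def)

text \<open>
  A permutation contributes only if it fixes every index outside \<open>S\<close>, because a unit column has a
  single nonzero entry, which lies on the diagonal.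
\<close>

lemma det_unit_cols_outside:
  assumes A: "A \<in> carrier_mat n n" and S: "S \<subseteq> {..<n}"
  shows "det (unit_cols_outside A S) = (\<Sum>p | p permutes S. signof p * (\<Prod>i\<in>S. A $$ (i, p i)))"
proof -
  let ?C = "unit_cols_outside A S"
  let ?t = "\<lambda>p. signof p * (\<Prod>i = 0..<n. ?C $$ (i, p i))"
  have S': "S \<subseteq> {0..<n}" using S by auto
  have "det ?C = (\<Sum>p | p permutes {0..<n}. ?t p)"
    by (rule det_def') (rule unit_cols_outside_carrier[OF A])
  also have "\<dots> = (\<Sum>p | p permutes S. ?t p)"
  proof (rule sum.mono_neutral_right)
    show "{p. p permutes S} \<subseteq> {p. p permutes {0..<n}}"
      using permutes_subset[OF _ S'] by auto
    show "\<forall>p\<in>{p. p permutes {0..<n}} - {p. p permutes S}. ?t p = 0"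
    proof
      fix p assume "p \<in> {p. p permutes {0..<n}} - {p. p permutes S}"
      then have p: "p permutes {0..<n}" and nS: "\<not> p permutes S" by auto
      have "\<exists>j. j \<notin> S \<and> p j \<noteq> j"
        using nS permutes_superset[OF p, of S] by blast
      then obtain j where j: "j \<notin> S" "p j \<noteq> j" by blast
      obtain i where pi: "p i = j" using permutes_surj[OF p] by (metis surjD)
      have "j < n" using j(2) permutes_not_in[OF p, of j] by auto
      then have i: "i < n" using pi permutes_in_image[OF p, of i] by auto
      have "i \<noteq> j" using pi j by auto
      then have "?C $$ (i, p i) = 0"
        unfolding pi using unit_cols_outside_index[OF A i \<open>j < n\<close>, of S] j by simp
      then have "(\<Prod>i = 0..<n. ?C $$ (i, p i)) = 0"
        using i by (intro prod_zero) auto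
      then show "?t p = 0" by simp
    qed
  qed (simp add: finite_permutations)
  also have "\<dots> = (\<Sum>p | p permutes S. signof p * (\<Prod>i\<in>S. A $$ (i, p i)))"
  proof (rule sum.cong[OF refl])
    fix p assume "p \<in> {p. p permutes S}"
    then have p: "p permutes S" by simp
    have lt: "i < n \<Longrightarrow> p i < n" for i
      using permutes_in_image[OF permutes_subset[OF p S'], of i] by auto
    have "(\<Prod>i = 0..<n. ?C $$ (i, p i)) = (\<Prod>i\<in>S. ?C $$ (i, p i))"
    proof (rule prod.mono_neutral_right)
      show "\<forall>i\<in>{0..<n} - S. ?C $$ (i, p i) = 1"
        using permutes_not_in[OF p] by (simp add: unit_cols_outside_index[OF A])
    qed (use S' in auto)
    also have "\<dots> = (\<Prod>i\<in>S. A $$ (i, p i))"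
      using S lt by (intro prod.cong refl)
        (auto simp: unit_cols_outside_index[OF A] permutes_in_image[OF p] subset_iff)
    finally show "?t p = signof p * (\<Prod>i\<in>S. A $$ (i, p i))" by simp
  qed
  finally show ?thesis .
qed

lemma bij_betw_pick:
  assumes "finite S"
  shows "bij_betw (pick S) {0..<card S} S"
proof -
  have "inj_on (pick S) {0..<card S}"
  proof (rule linorder_inj_onI)
    fix a b assume "a < b" "b \<in> {0..<card S}"
    then show "pick S a \<noteq> pick S b"
      using pick_mono[of b S a] by auto
  qed auto
  moreover have "pick S ` {0..<card S} \<subseteq> S"
    using pick_in_set[of _ S] by auto
  ultimately show ?thesis
    using assms by (metis bij_betw_def card_atLeastLessThan card_image card_subset_eq diff_zero)
qed

text \<open>
  The order-preserving enumeration of \<open>S\<close> that defines the submatrix transports permutations of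
  its positions to permutations of \<open>S\<close> and preserves their signs, so the enumeration disappears
  from the Leibniz formula.
\<close>

lemma principal_minor_Leibniz:
  assumes A: "A \<in> carrier_mat n n" and S: "S \<subseteq> {..<n}"
  shows "principal_minor A S = (\<Sum>p | p permutes S. signof p * (\<Prod>i\<in>S. A $$ (i, p i)))"
proof -
  define m where "m = card S"
  let ?f = "pick S"
  have eq: "{i. i < n \<and> i \<in> S} = S" using S by auto
  have fin: "finite S" using S finite_subset by blast
  have f: "bij_betw ?f {0..<m} S" unfolding m_def by (rule bij_betw_pick[OF fin])
  have inj: "inj_on ?f {0..<m}" using f by (simp add: bij_betw_def)
  have sub: "submatrix A S S = mat m m (\<lambda>(i, j). A $$ (?f i, ?f j))"
    using A unfolding submatrix_def m_def by (simp add: eq)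
  have "principal_minor A S = (\<Sum>q | q permutes {0..<m}. signof q * (\<Prod>i = 0..<m. A $$ (?f i, ?f (q i))))"
    unfolding principal_minor_def sub
    by (subst det_def') (auto intro!: sum.cong prod.cong simp: permutes_in_image)
  also have "\<dots> = (\<Sum>q | q permutes {0..<m}.
      signof (map_permutation {0..<m} ?f q) * (\<Prod>i\<in>S. A $$ (i, map_permutation {0..<m} ?f q i)))"
  proof (rule sum.cong[OF refl])
    fix q assume "q \<in> {q. q permutes {0..<m}}"
    then have q: "q permutes {0..<m}" by simp
    have "(\<Prod>i\<in>S. A $$ (i, map_permutation {0..<m} ?f q i)) =
        (\<Prod>i = 0..<m. A $$ (?f i, map_permutation {0..<m} ?f q (?f i)))"
      by (rule prod.reindex_bij_betw[OF f, symmetric])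
    also have "\<dots> = (\<Prod>i = 0..<m. A $$ (?f i, ?f (q i)))"
      by (intro prod.cong refl) (simp add: map_permutation_apply[OF inj])
    finally show "signof q * (\<Prod>i = 0..<m. A $$ (?f i, ?f (q i))) =
        signof (map_permutation {0..<m} ?f q) * (\<Prod>i\<in>S. A $$ (i, map_permutation {0..<m} ?f q i))"
      using sign_map_permutation[OF inj q] by simp
  qed
  also have "\<dots> = (\<Sum>p | p permutes S. signof p * (\<Prod>i\<in>S. A $$ (i, p i)))"
  proof (rule sum.reindex_bij_betw)
    have "bij_betw (\<lambda>\<pi> x. if x \<in> S then ?f (\<pi> (inv_into {0..<m} ?f x)) else x)
        {\<pi>. \<pi> permutes {0..<m}} {\<pi>. \<pi> permutes S}"
      by (rule bij_betw_permutations[OF f])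
    moreover have "map_permutation {0..<m} ?f =
        (\<lambda>\<pi> x. if x \<in> S then ?f (\<pi> (inv_into {0..<m} ?f x)) else x)"
      using f by (auto simp: fun_eq_iff map_permutation_def restrict_id_def bij_betw_def)
    ultimately show "bij_betw (map_permutation {0..<m} ?f) {q. q permutes {0..<m}} {p. p permutes S}"
      by simp
  qed
  finally show ?thesis .
qed

lemma principal_minor_eq_det:
  assumes "A \<in> carrier_mat n n" "S \<subseteq> {..<n}"
  shows "principal_minor A S = det (unit_cols_outside A S)"
  using principal_minor_Leibniz[OF assms] det_unit_cols_outside[OF assms] by simp

lemma principal_minor_singleton:
  assumes "A \<in> carrier_mat n n" "x < n"
  shows "principal_minor A {x} = A $$ (x, x)"
  using assms by (subst principal_minor_Leibniz) auto

lemma principal_minor_doubleton: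
  assumes "A \<in> carrier_mat n n" "x < n" "y < n" "x \<noteq> y"
  shows "principal_minor A {x, y} = A $$ (x, x) * A $$ (y, y) - A $$ (x, y) * A $$ (y, x)"
  using assms
  by (subst principal_minor_Leibniz)
    (auto simp: sum_over_permutations_insert sign_swap_id)

lemma principal_minor_nonzero_row:
  assumes A: "A \<in> carrier_mat n n" and S: "S \<subseteq> {..<n}"
    and nz: "principal_minor A S \<noteq> 0" and x: "x \<in> S"
  obtains y where "y \<in> S" "A $$ (x, y) \<noteq> 0"
proof -
  have "\<exists>y\<in>S. A $$ (x, y) \<noteq> 0"
  proof (rule ccontr)
    assume zero: "\<not> (\<exists>y\<in>S. A $$ (x, y) \<noteq> 0)"
    have "(\<Prod>i\<in>S. A $$ (i, p i)) = 0" if "p permutes S" for p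
      using x zero permutes_in_image[OF that] S
      by (intro prod_zero) (auto intro: finite_subset)
    then have "principal_minor A S = 0"
      unfolding principal_minor_Leibniz[OF A S] by simp
    with nz show False by simp
  qed
  with that show thesis by blast
qed

section \<open>Block structure and the principal pivot transform\<close>

lemma sum_mult_delta:
  fixes g :: "nat \<Rightarrow> complex"
  assumes "j < n"
  shows "(\<Sum>l = 0..<n. g l * (if l = j then 1 else 0)) = g j"
  using assms by (simp add: if_distrib cong: if_cong)

lemma principal_minor_block:
  assumes A: "A \<in> carrier_mat n n" and S: "S \<subseteq> {..<n}" and T: "T \<subseteq> {..<n}"
    and disj: "S \<inter> T = {}" and zero: "\<And>i j. i \<in> S \<Longrightarrow> j \<in> T \<Longrightarrow> A $$ (i, j) = 0"
  shows "principal_minor A (S \<union> T) = principal_minor A S * principal_minor A T"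
proof -
  note C = unit_cols_outside_carrier[OF A] and C_index = unit_cols_outside_index[OF A]
  have "unit_cols_outside A (S \<union> T) = unit_cols_outside A S * unit_cols_outside A T"
  proof (rule eq_matI)
    fix i j assume "i < dim_row (unit_cols_outside A S * unit_cols_outside A T)"
      and "j < dim_col (unit_cols_outside A S * unit_cols_outside A T)"
    with C[of S] C[of T] have ij: "i < n" "j < n" by auto
    have prod: "(unit_cols_outside A S * unit_cols_outside A T) $$ (i, j) =
        (\<Sum>l = 0..<n. unit_cols_outside A S $$ (i, l) * unit_cols_outside A T $$ (l, j))"
      using C[of S] C[of T] ij by (simp add: scalar_prod_def)
    show "unit_cols_outside A (S \<union> T) $$ (i, j) =
        (unit_cols_outside A S * unit_cols_outside A T) $$ (i, j)"
    proof (cases "j \<in> T")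
      case True
      \<comment> \<open>Column \<open>j\<close> of \<open>A\<close> vanishes on \<open>S\<close>, and the left factor fixes such vectors.\<close>
      have "unit_cols_outside A S $$ (i, l) * unit_cols_outside A T $$ (l, j) =
          (if i = l then A $$ (l, j) else 0)" if "l < n" for l
        using that True disj ij zero by (auto simp: C_index)
      then show ?thesis
        unfolding prod using ij True by (simp add: C_index)
    next
      case False
      then have "unit_cols_outside A S $$ (i, l) * unit_cols_outside A T $$ (l, j) =
          unit_cols_outside A S $$ (i, l) * (if l = j then 1 else 0)" if "l < n" for l
        using that ij by (simp add: C_index)
      then show ?thesis
        unfolding prod using ij False sum_mult_delta[OF ij(2)]
        by (simp add: C_index)
    qed
  qed (simp_all add: carrier_matD[OF C])
  then show ?thesis
    using A S T C by (simp add: principal_minor_eq_det det_mult[of _ n])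
qed

text \<open>
  Let \<open>C\<close> be \<open>B\<close> with the columns outside \<open>F\<close> replaced by unit vectors, and \<open>R\<close> the same with the
  columns inside \<open>F\<close> replaced. Since \<open>det C\<close> is the minor on \<open>F\<close>, the equation \<open>C * M = R\<close> has a
  solution \<open>M\<close>; this is the principal pivot transform.
  Multiplication by \<open>C\<close> exchanges columns of \<open>M\<close> and unit vectors for columns of \<open>B\<close> and unit
  vectors. The minor formula is the determinant of this exchange.

  For the symmetry of \<open>M\<close>, rewrite \<open>C * M = R\<close> as \<open>B * Z = W\<close>, where \<open>Z\<close> agrees with \<open>M\<close> on the
  rows in \<open>F\<close> and with minus the identity on the others, and \<open>W\<close> agrees with the identity on the rows
  in \<open>F\<close> and with \<open>- M\<close> on the others. As \<open>B\<close> is Hermitian, so is \<open>Z\<^sup>* B Z = Z\<^sup>* W\<close>, whose entries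
  are entries of \<open>M\<close> and their conjugates.
\<close>

lemma principal_pivot_exists:
  assumes B: "B \<in> carrier_mat n n" and herm: "hermitian_mat B"
    and F: "F \<subseteq> {..<n}" and nz: "principal_minor B F \<noteq> 0"
  obtains M where "M \<in> carrier_mat n n"
    "\<And>S. S \<subseteq> {..<n} \<Longrightarrow>
      principal_minor B S = principal_minor B F * principal_minor M (sym_diff F S)"
    "\<And>i j. i < n \<Longrightarrow> j < n \<Longrightarrow> (i \<in> F \<longleftrightarrow> j \<in> F) \<Longrightarrow> M $$ (i, j) = cnj (M $$ (j, i))"
    "\<And>i j. i < n \<Longrightarrow> j < n \<Longrightarrow> \<not> (i \<in> F \<longleftrightarrow> j \<in> F) \<Longrightarrow> M $$ (i, j) = - cnj (M $$ (j, i))"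
proof -
  define C where "C = unit_cols_outside B F"
  define R where "R = unit_cols_outside B ({..<n} - F)"
  note carr = unit_cols_outside_carrier[OF B] and index = unit_cols_outside_index[OF B]
  have C: "C \<in> carrier_mat n n" and R: "R \<in> carrier_mat n n"
    unfolding C_def R_def by (rule carr)+
  have "det C \<noteq> 0"
    using nz principal_minor_eq_det[OF B F] by (simp add: C_def)
  then have "C \<in> Units (ring_mat TYPE(complex) n undefined)"
    by (rule det_non_zero_imp_unit[OF C])
  then obtain D where D: "D \<in> carrier_mat n n" and CD: "C * D = 1\<^sub>m n"
    unfolding Units_def by (auto simp: ring_mat_simps)
  define M where "M = D * R"
  have M: "M \<in> carrier_mat n n" using D R by (simp add: M_def)
  have "C * M = R"
    unfolding M_def using C D R CD by (simp flip: assoc_mult_mat[of C n n D n R n])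
  then have CM: "(\<Sum>l = 0..<n. C $$ (i, l) * M $$ (l, j)) =
      (if j \<in> F then if i = j then 1 else 0 else B $$ (i, j))" if "i < n" "j < n" for i j
  proof -
    have "(\<Sum>l = 0..<n. C $$ (i, l) * M $$ (l, j)) = (C * M) $$ (i, j)"
      using C M that by (simp add: scalar_prod_def)
    also have "\<dots> = R $$ (i, j)" using \<open>C * M = R\<close> by simp
    also have "\<dots> = (if j \<in> F then if i = j then 1 else 0 else B $$ (i, j))"
      using that by (auto simp: R_def index)
    finally show ?thesis .
  qed
  show thesis
  proof (rule that[OF M])
    fix S assume S: "S \<subseteq> {..<n}"
    let ?G = "sym_diff F S"
    have G: "?G \<subseteq> {..<n}" using F S by auto
    note carrM = unit_cols_outside_carrier[OF M] and indexM = unit_cols_outside_index[OF M]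
    have "unit_cols_outside B S = C * unit_cols_outside M ?G"
    proof (rule eq_matI)
      fix i j assume "i < dim_row (C * unit_cols_outside M ?G)" "j < dim_col (C * unit_cols_outside M ?G)"
      with C carrM[of ?G] have ij: "i < n" "j < n" by auto
      have prod: "(C * unit_cols_outside M ?G) $$ (i, j) =
          (\<Sum>l = 0..<n. C $$ (i, l) * unit_cols_outside M ?G $$ (l, j))"
        using C carrM[of ?G] ij by (simp add: scalar_prod_def)
      show "unit_cols_outside B S $$ (i, j) = (C * unit_cols_outside M ?G) $$ (i, j)"
      proof (cases "j \<in> ?G")
        case True
        then have "(C * unit_cols_outside M ?G) $$ (i, j) = (\<Sum>l = 0..<n. C $$ (i, l) * M $$ (l, j))"
          unfolding prod using ij by (intro sum.cong) (auto simp: indexM)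
        then show ?thesis
          using CM[OF ij] ij True by (auto simp: index)
      next
        case False
        then have "(C * unit_cols_outside M ?G) $$ (i, j) =
            (\<Sum>l = 0..<n. C $$ (i, l) * (if l = j then 1 else 0))"
          unfolding prod using ij by (intro sum.cong) (auto simp: indexM)
        then show ?thesis
          using sum_mult_delta[OF ij(2)] ij False by (auto simp: index C_def)
      qed
    qed (simp_all add: carrier_matD[OF C] carrier_matD[OF carr] carrier_matD[OF carrM])
    then show "principal_minor B S = principal_minor B F * principal_minor M ?G"
      using principal_minor_eq_det[OF B F] principal_minor_eq_det[OF B S]
        principal_minor_eq_det[OF M G] det_mult[OF C carrM] by (simp add: C_def)
  next
    define Z where "Z = (\<lambda>a j. if a \<in> F then M $$ (a, j) else if a = j then - 1 else 0)"
    define W where "W = (\<lambda>a j. if a \<in> F then if a = j then 1 else 0 else - M $$ (a, j))"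
    have BZ: "(\<Sum>b = 0..<n. B $$ (a, b) * Z b j) = W a j" if aj: "a < n" "j < n" for a j
    proof -
      have "(\<Sum>b = 0..<n. B $$ (a, b) * Z b j) =
          (\<Sum>b = 0..<n. C $$ (a, b) * M $$ (b, j)
            - (if b = a then if a \<in> F then 0 else M $$ (a, j) else 0)
            - (if b = j then if j \<in> F then 0 else B $$ (a, j) else 0))"
        using aj by (intro sum.cong refl) (auto simp: Z_def C_def index)
      also have "\<dots> = W a j"
        using aj CM[OF aj] by (auto simp: sum_subtractf W_def)
      finally show ?thesis .
    qed
    \<comment> \<open>The entry \<open>(i, j)\<close> of the equation \<open>Z\<^sup>* W = W\<^sup>* Z\<close>.\<close>
    have twist: "(if j \<in> F then cnj (M $$ (j, i)) else 0) + (if i \<in> F then 0 else M $$ (i, j)) =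
        (if i \<in> F then M $$ (i, j) else 0) + (if j \<in> F then 0 else cnj (M $$ (j, i)))"
      if ij: "i < n" "j < n" for i j
    proof -
      have "(\<Sum>a = 0..<n. cnj (Z a i) * W a j) =
          (\<Sum>a = 0..<n. \<Sum>b = 0..<n. cnj (Z a i) * (B $$ (a, b) * Z b j))"
        using BZ ij by (simp flip: sum_distrib_left)
      also have "\<dots> = (\<Sum>b = 0..<n. \<Sum>a = 0..<n. cnj (Z a i) * (B $$ (a, b) * Z b j))"
        by (rule sum.swap)
      also have "\<dots> = (\<Sum>b = 0..<n. \<Sum>a = 0..<n. cnj (B $$ (b, a) * Z a i) * Z b j)"
      proof (intro sum.cong refl)
        fix a b assume "a \<in> {0..<n}" "b \<in> {0..<n}"
        then have "B $$ (a, b) = cnj (B $$ (b, a))"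
          using B by (intro hermitian_mat_index[OF herm]) auto
        then show "cnj (Z a i) * (B $$ (a, b) * Z b j) = cnj (B $$ (b, a) * Z a i) * Z b j"
          by (simp only: complex_cnj_mult complex_cnj_cnj mult_ac)
      qed
      also have "\<dots> = (\<Sum>b = 0..<n. cnj (W b i) * Z b j)"
      proof (rule sum.cong[OF refl])
        fix b assume "b \<in> {0..<n}"
        then have "W b i = (\<Sum>a = 0..<n. B $$ (b, a) * Z a i)"
          using BZ[of b i] ij by simp
        then show "(\<Sum>a = 0..<n. cnj (B $$ (b, a) * Z a i) * Z b j) = cnj (W b i) * Z b j"
          by (simp only: cnj_sum sum_distrib_right)
      qed
      finally have form: "(\<Sum>a = 0..<n. cnj (Z a i) * W a j) = (\<Sum>a = 0..<n. cnj (W a i) * Z a j)" .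
      have "(\<Sum>a = 0..<n. cnj (Z a i) * W a j) =
          (\<Sum>a = 0..<n. (if a = j then if j \<in> F then cnj (M $$ (j, i)) else 0 else 0)
            + (if a = i then if i \<in> F then 0 else M $$ (i, j) else 0))"
        by (intro sum.cong refl) (auto simp: Z_def W_def)
      moreover have "(\<Sum>a = 0..<n. cnj (W a i) * Z a j) =
          (\<Sum>a = 0..<n. (if a = i then if i \<in> F then M $$ (i, j) else 0 else 0)
            + (if a = j then if j \<in> F then 0 else cnj (M $$ (j, i)) else 0))"
        by (intro sum.cong refl) (auto simp: Z_def W_def)
      ultimately show ?thesis
        using form ij by (simp add: sum.distrib)
    qed
    fix i j assume ij: "i < n" "j < n"
    show "M $$ (i, j) = cnj (M $$ (j, i))" if "i \<in> F \<longleftrightarrow> j \<in> F"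
      using twist[OF ij] that by (auto split: if_splits)
    show "M $$ (i, j) = - cnj (M $$ (j, i))" if "\<not> (i \<in> F \<longleftrightarrow> j \<in> F)"
      using twist[OF ij] that by (auto split: if_splits simp: add_eq_0_iff)
  qed
qed

section \<open>Signs of consecutive minors\<close>

lemma nonneg_if_neg_mult_nonpos:
  fixes c z :: complex
  assumes "c < 0" "c * z \<le> 0"
  shows "0 \<le> z"
  using assms by (auto simp: less_complex_def less_eq_complex_def mult_le_0_iff)

lemma nonpos_if_neg_mult_nonneg:
  fixes c z :: complex
  assumes "c < 0" "0 \<le> c * z"
  shows "z \<le> 0"
  using assms by (auto simp: less_complex_def less_eq_complex_def zero_le_mult_iff)

text \<open>
  The descent on the distance of \<open>F\<close> from \<open>T\<close> described at the beginning, stated as an induction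
  on \<open>card (F - T)\<close>.
\<close>

lemma no_sign_change_between_nonpos_minors:
  assumes B: "B \<in> carrier_mat n n" and herm: "hermitian_mat B"
    and k: "\<And>S. S \<subseteq> {..<n} \<Longrightarrow> card S = k \<Longrightarrow> principal_minor B S \<le> 0"
    and k2: "\<And>S. S \<subseteq> {..<n} \<Longrightarrow> card S = Suc (Suc k) \<Longrightarrow> principal_minor B S \<le> 0"
    and T: "T \<subseteq> {..<n}" "card T = Suc k" "0 < principal_minor B T"
    and F: "F \<subseteq> {..<n}" "card F = Suc k" "principal_minor B F < 0"
  shows False
  using F
proof (induction "card (F - T)" arbitrary: F rule: less_induct)
  case less
  note F = less.prems
  let ?f = "principal_minor B"
  have finF: "finite F" and finT: "finite T" using F(1) T(1) finite_subset by auto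
  have nzF: "?f F \<noteq> 0" using F(3) by auto
  obtain M where M: "M \<in> carrier_mat n n"
    and pivot: "\<And>S. S \<subseteq> {..<n} \<Longrightarrow> ?f S = ?f F * principal_minor M (sym_diff F S)"
    and same: "\<And>i j. i < n \<Longrightarrow> j < n \<Longrightarrow> (i \<in> F \<longleftrightarrow> j \<in> F) \<Longrightarrow> M $$ (i, j) = cnj (M $$ (j, i))"
    and opp: "\<And>i j. i < n \<Longrightarrow> j < n \<Longrightarrow> \<not> (i \<in> F \<longleftrightarrow> j \<in> F) \<Longrightarrow> M $$ (i, j) = - cnj (M $$ (j, i))"
    by (rule principal_pivot_exists[OF B herm F(1) nzF]) (rule that; blast)
  let ?m = "principal_minor M"
  define P where "P = F - T"
  define Q where "Q = T - F"
  have P: "P \<subseteq> {..<n}" "P \<subseteq> F" "finite P" and Q: "Q \<subseteq> {..<n}" "Q \<inter> F = {}" "finite Q"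
    using F(1) T(1) finF finT by (auto simp: P_def Q_def)
  have ltn: "x \<in> P \<Longrightarrow> x < n" "x \<in> Q \<Longrightarrow> x < n" for x using P Q by auto
  have F_T: "F \<noteq> T" using F(3) T(3) by (metis less_asym)
  have PQ_ne: "P \<noteq> {}" "Q \<noteq> {}"
    using F_T card_subset_eq[OF finT, of F] card_subset_eq[OF finF, of T] F(2) T(2)
    by (auto simp: P_def Q_def)
  have exch: "?f (F - X \<union> Y) = ?f F * ?m (X \<union> Y)" if "X \<subseteq> P" "Y \<subseteq> Q" for X Y
  proof -
    have "sym_diff F (F - X \<union> Y) = X \<union> Y" "F - X \<union> Y \<subseteq> {..<n}"
      using that P Q F(1) by auto
    then show ?thesis using pivot[of "F - X \<union> Y"] by simp
  qed
  have cards: "card (F - X \<union> Y) + card X = Suc k + card Y" if "X \<subseteq> P" "Y \<subseteq> Q" for X Y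
  proof -
    have fin: "finite X" "finite Y" using that P(3) Q(3) finite_subset by auto
    have "card (F - X \<union> Y) = card (F - X) + card Y"
      using fin finF that Q(2) by (intro card_Un_disjoint) auto
    moreover have "card (F - X) = card F - card X" "card X \<le> card F"
      using that P(2) finF fin by (auto intro!: card_Diff_subset card_mono)
    ultimately show ?thesis using F(2) by simp
  qed
  \<comment> \<open>Exchanges that change the size by one lead to the orders \<open>k\<close> and \<open>k + 2\<close>.\<close>
  have bal_off: "0 \<le> ?m (X \<union> Y)"
    if "X \<subseteq> P" "Y \<subseteq> Q" "card X = Suc (card Y) \<or> card Y = Suc (card X)" for X Y
  proof -
    have "F - X \<union> Y \<subseteq> {..<n}" using that P Q F(1) by auto
    moreover have "card (F - X \<union> Y) = k \<or> card (F - X \<union> Y) = Suc (Suc k)"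
      using cards[OF that(1,2)] that(3) by auto
    ultimately have "?f (F - X \<union> Y) \<le> 0" using k k2 by blast
    then show ?thesis
      using nonneg_if_neg_mult_nonpos[OF F(3)] exch[OF that(1,2)] by simp
  qed
  \<comment> \<open>Exchanges that keep the size lead nearer to \<open>T\<close>, where the induction hypothesis applies.\<close>
  have bal: "?m (X \<union> Y) \<le> 0"
    if "X \<subseteq> P" "Y \<subseteq> Q" "card X = card Y" "X \<noteq> {}" for X Y
  proof -
    have sub: "F - X \<union> Y \<subseteq> {..<n}" using that P Q F(1) by auto
    have card: "card (F - X \<union> Y) = Suc k"
      using cards[OF that(1,2)] that(3) by auto
    have "F - X \<union> Y - T = P - X" using that by (auto simp: P_def Q_def)
    moreover have "card (P - X) < card P"
      using that(1,4) P(3) by (intro psubset_card_mono) auto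
    ultimately have "\<not> ?f (F - X \<union> Y) < 0"
      using less.hyps[OF _ sub card] by (auto simp: P_def)
    moreover have "?f (F - X \<union> Y) \<in> \<real>" by (rule principal_minor_real[OF herm])
    ultimately have "0 \<le> ?f (F - X \<union> Y)"
      by (auto simp: complex_is_Real_iff less_complex_def less_eq_complex_def)
    then show ?thesis
      using nonpos_if_neg_mult_nonneg[OF F(3)] exch[OF that(1,2)] by simp
  qed
  have dP: "0 \<le> M $$ (x, x)" if "x \<in> P" for x
    using bal_off[of "{x}" "{}"] that principal_minor_singleton[OF M, of x] ltn by simp
  have dQ: "0 \<le> M $$ (y, y)" if "y \<in> Q" for y
    using bal_off[of "{}" "{y}"] that principal_minor_singleton[OF M, of y] ltn by simp
  have cross: "M $$ (x, x) * M $$ (y, y) = 0 \<and> M $$ (x, y) = 0" if "x \<in> P" "y \<in> Q" for x y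
  proof -
    have xy: "x < n" "y < n" "x \<noteq> y" "x \<in> F" "y \<notin> F" using that P Q ltn by auto
    have "?m {x, y} \<le> 0" using bal[of "{x}" "{y}"] that by (simp add: insert_commute)
    moreover have "M $$ (y, x) = - cnj (M $$ (x, y))" using xy by (intro opp) auto
    ultimately have le: "M $$ (x, x) * M $$ (y, y) + M $$ (x, y) * cnj (M $$ (x, y)) \<le> 0"
      using principal_minor_doubleton[OF M xy(1-3)] by simp
    have nn: "0 \<le> M $$ (x, x) * M $$ (y, y)"
      using dP[OF that(1)] dQ[OF that(2)] by (rule mult_nonneg_nonneg)
    have nn': "0 \<le> M $$ (x, y) * cnj (M $$ (x, y))"
      by (simp add: complex_norm_square[symmetric] less_eq_complex_def)
    have "M $$ (x, x) * M $$ (y, y) + M $$ (x, y) * cnj (M $$ (x, y)) = 0"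
      by (rule order.antisym[OF le add_nonneg_nonneg[OF nn nn']])
    then have "M $$ (x, x) * M $$ (y, y) = 0 \<and> M $$ (x, y) * cnj (M $$ (x, y)) = 0"
      unfolding add_nonneg_eq_0_iff[OF nn nn'] .
    then show ?thesis by simp
  qed
  have block: "?m (X \<union> Y) = ?m X * ?m Y" if "X \<subseteq> P" "Y \<subseteq> Q" for X Y
  proof (rule principal_minor_block[OF M])
    show "X \<subseteq> {..<n}" "Y \<subseteq> {..<n}" using that P Q by auto
    show "X \<inter> Y = {}" using that unfolding P_def Q_def by blast
    show "M $$ (i, j) = 0" if "i \<in> X" "j \<in> Y" for i j
      using cross[of i j] that \<open>X \<subseteq> P\<close> \<open>Y \<subseteq> Q\<close> by auto
  qed
  have nz: "?m (P \<union> Q) \<noteq> 0"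
  proof -
    have "F - P \<union> Q = T" by (auto simp: P_def Q_def)
    then show ?thesis using exch[of P Q] T(3) by auto
  qed
  have pair: "?m {z, w} < 0"
    if "z < n" "w < n" "z \<noteq> w" "z \<in> F \<longleftrightarrow> w \<in> F" "M $$ (z, z) = 0" "M $$ (z, w) \<noteq> 0" for z w
  proof -
    have "M $$ (w, z) = cnj (M $$ (z, w))" using that by (intro same) auto
    then have "?m {z, w} = - (M $$ (z, w) * cnj (M $$ (z, w)))"
      using principal_minor_doubleton[OF M that(1-3)] that(5) by simp
    also have "\<dots> = - of_real ((cmod (M $$ (z, w)))\<^sup>2)"
      by (simp only: complex_norm_square)
    finally show ?thesis using that(6) by (simp add: less_complex_def flip: of_real_power)
  qed
  have pairP: "\<exists>x'\<in>P. x' \<noteq> x \<and> ?m {x, x'} < 0" if x: "x \<in> P" "M $$ (x, x) = 0" for x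
  proof -
    obtain z where z: "z \<in> P \<union> Q" "M $$ (x, z) \<noteq> 0"
      using principal_minor_nonzero_row[OF M _ nz, of x] P Q x by auto
    have "z \<in> P" "z \<noteq> x" using z cross x by auto
    moreover have "x \<in> F \<longleftrightarrow> z \<in> F" using x \<open>z \<in> P\<close> P(2) by blast
    ultimately have "?m {x, z} < 0" using x z ltn by (intro pair) auto
    with \<open>z \<in> P\<close> \<open>z \<noteq> x\<close> show ?thesis by blast
  qed
  have pairQ: "\<exists>y'\<in>Q. y' \<noteq> y \<and> ?m {y, y'} < 0" if y: "y \<in> Q" "M $$ (y, y) = 0" for y
  proof -
    obtain z where z: "z \<in> P \<union> Q" "M $$ (y, z) \<noteq> 0"
      using principal_minor_nonzero_row[OF M _ nz, of y] P Q y by auto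
    have "z \<notin> P"
    proof
      assume zP: "z \<in> P"
      then have "M $$ (y, z) = - cnj (M $$ (z, y))" using y P Q ltn by (intro opp) auto
      then show False using cross[OF zP y(1)] z by simp
    qed
    then have "z \<in> Q" "z \<noteq> y" using z y by auto
    moreover have "y \<in> F \<longleftrightarrow> z \<in> F" using y \<open>z \<in> Q\<close> Q(2) by blast
    ultimately have "?m {y, z} < 0" using y z ltn by (intro pair) auto
    with \<open>z \<in> Q\<close> \<open>z \<noteq> y\<close> show ?thesis by blast
  qed
  obtain x y where x: "x \<in> P" and y: "y \<in> Q" using PQ_ne by blast
  \<comment> \<open>One of the two entries vanishes by \<open>cross\<close>; the negative pair at it kills the other one.\<close>
  have zero: "M $$ (x, x) = 0 \<and> M $$ (y, y) = 0"
  proof (cases "M $$ (x, x) = 0")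
    case True
    obtain x' where x': "x' \<in> P" "x' \<noteq> x" "?m {x, x'} < 0" using pairP[OF x True] by blast
    have "0 \<le> ?m ({x, x'} \<union> {y})"
      using x y x' by (intro bal_off) auto
    then have "0 \<le> ?m {x, x'} * M $$ (y, y)"
      using block[of "{x, x'}" "{y}"] x y x' principal_minor_singleton[OF M ltn(2)[OF y]] by simp
    then show ?thesis
      using nonpos_if_neg_mult_nonneg[OF x'(3)] dQ[OF y] True by (simp add: order.antisym)
  next
    case False
    then have y0: "M $$ (y, y) = 0" using cross[OF x y] by simp
    obtain y' where y': "y' \<in> Q" "y' \<noteq> y" "?m {y, y'} < 0" using pairQ[OF y y0] by blast
    have "0 \<le> ?m ({x} \<union> {y, y'})"
      using x y y' by (intro bal_off) auto
    then have "0 \<le> ?m {y, y'} * M $$ (x, x)"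
      using block[of "{x}" "{y, y'}"] x y y' principal_minor_singleton[OF M ltn(1)[OF x]]
      by (simp add: mult.commute)
    then show ?thesis
      using nonpos_if_neg_mult_nonneg[OF y'(3)] dP[OF x] y0 by (simp add: order.antisym)
  qed
  obtain x' where x': "x' \<in> P" "x' \<noteq> x" "?m {x, x'} < 0" using pairP[OF x] zero by blast
  obtain y' where y': "y' \<in> Q" "y' \<noteq> y" "?m {y, y'} < 0" using pairQ[OF y] zero by blast
  have "?m ({x, x'} \<union> {y, y'}) \<le> 0"
    using x y x' y' by (intro bal) auto
  then have "?m {x, x'} * ?m {y, y'} \<le> 0"
    using block[of "{x, x'}" "{y, y'}"] x y x' y' by simp
  then have "0 \<le> ?m {y, y'}"
    by (rule nonneg_if_neg_mult_nonpos[OF x'(3)])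
  with y'(3) show False by simp
qed

text \<open>
  Both symbols \<open>A_minus\<close> and \<open>S_minus\<close> make all minors of their order nonpositive, while \<open>S_star\<close>
  provides minors of both signs.
\<close>

lemma no_S_star_between_nonpos:
  assumes B: "B \<in> carrier_mat n n" and herm: "hermitian_mat B"
    and first: "first \<in> {A_minus, S_minus}"
  shows "\<not> sublist [first, S_star, S_minus] (sepr B)"
proof
  assume "sublist [first, S_star, S_minus] (sepr B)"
  then obtain ps ss where split: "sepr B = ps @ [first, S_star, S_minus] @ ss"
    unfolding sublist_def by blast
  define k where "k = Suc (length ps)"
  have len: "length ps + 3 + length ss = n"
    using arg_cong[OF split, of length] B by (simp add: sepr_def del: upt_Suc)
  have nth: "sepr B ! i = sepr_symbol_of B (Suc i)" if "i < n" for i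
    using that B by (simp add: sepr_def del: upt_Suc)
  have "sepr_symbol_of B k = first" "sepr_symbol_of B (Suc k) = S_star"
      "sepr_symbol_of B (Suc (Suc k)) = S_minus"
    using nth[of "length ps"] nth[of "Suc (length ps)"] nth[of "Suc (Suc (length ps))"] len
    unfolding split k_def by (simp_all add: nth_append)
  moreover have "k \<le> dim_row B" "Suc k \<le> dim_row B" "Suc (Suc k) \<le> dim_row B"
    using len B by (auto simp: k_def)
  ultimately have
      lo: "\<forall>d\<in>principal_minors B k. d \<le> 0" and
      hi: "\<forall>d\<in>principal_minors B (Suc (Suc k)). d \<le> 0" and
      mid: "\<exists>d\<in>principal_minors B (Suc k). 0 < d" "\<exists>d\<in>principal_minors B (Suc k). d < 0"
    using first sepr_symbol_of_iff[OF herm] by (auto simp: order.order_iff_strict)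
  have mem: "principal_minor B S \<in> principal_minors B (card S)" if "S \<subseteq> {..<n}" for S
    using that B unfolding principal_minors_def by auto
  obtain T F where T: "T \<subseteq> {..<n}" "card T = Suc k" "0 < principal_minor B T"
    and F: "F \<subseteq> {..<n}" "card F = Suc k" "principal_minor B F < 0"
    using mid B unfolding principal_minors_def by auto
  have "principal_minor B S \<le> 0" if "S \<subseteq> {..<n}" "card S = k" for S
    using mem[OF that(1)] that(2) lo by simp
  moreover have "principal_minor B S \<le> 0" if "S \<subseteq> {..<n}" "card S = Suc (Suc k)" for S
    using mem[OF that(1)] that(2) hi by simp
  ultimately show False
    by (rule no_sign_change_between_nonpos_minors[OF B herm _ _ T F])
qed

theorem theorem4p4:
  fixes B :: "complex mat" and n :: nat
  assumes "B \<in> carrier_mat n n" and "hermitian_mat B"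
  shows "\<not> sublist [A_minus, S_star, S_minus] (sepr B)
       \<and> \<not> sublist [S_minus, S_star, S_minus] (sepr B)"
  using no_S_star_between_nonpos[OF assms] by simp

end
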